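(* Let $\lambda>0$. Up to translation in $x$, there is a unique nonnegative nontrivial (i.e. not identically zero) steady state $\varphi$ of the equation $\partial_t u=\partial_{xx}u+\lambda\,u\ln(u^2)$ on $\mathbb{R}$, i.e. a solution of $$\varphi''(x)+2\lambda\,\varphi(x)\ln\varphi(x)=0,\qquad x\in\mathbb{R},$$ satisfying $\varphi(\pm\infty)=0$. It is the Gaussian given by $$\varphi(x)=e^{\frac12}e^{-\frac{\lambda}{2}x^2}.$$
   Context: Steady states are understood as $C^2$ functions on $\mathbb{R}$. The nonlinearity $z\mapsto 2\lambda z\ln z$ is extended by the value $0$ at $z=0$. The notation $\varphi(\pm\infty)=0$ means $\varphi(x)\to0$ as $x\to+\infty$ and as $x\to-\infty$. *)

theory Defs
  imports "HOL-Analysis.Analysis"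
begin

definition C2_real :: "(real \<Rightarrow> real) \<Rightarrow> bool" where
  "C2_real f \<longleftrightarrow>
     (\<forall>x. f differentiable (at x)) \<and>
     (\<forall>x. deriv f differentiable (at x)) \<and>
     continuous_on UNIV (deriv (deriv f))"

definition log_heat_nonlinearity :: "real \<Rightarrow> real \<Rightarrow> real" where
  "log_heat_nonlinearity lam z = (if z = 0 then 0 else lam * z * ln (z\<^sup>2))"

definition ode_nonlinearity :: "real \<Rightarrow> real \<Rightarrow> real" where
  "ode_nonlinearity lam z = (if z = 0 then 0 else 2 * lam * z * ln z)"

text \<open>
  The equation \<open>u_t = u_xx + lam * u * ln (u^2)\<close> on \<open>(0, \<infinity>) \<times> \<real>\<close>, with \<open>u t x\<close> the value at
  time \<open>t\<close> and position \<open>x\<close>. The second space derivative is written with the total function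
  \<open>deriv\<close>, so regularity in \<open>x\<close> has to be required separately.
\<close>

definition log_heat_equation :: "real \<Rightarrow> (real \<Rightarrow> real \<Rightarrow> real) \<Rightarrow> bool" where
  "log_heat_equation lam u \<longleftrightarrow>
     (\<forall>t>0. \<forall>x. ((\<lambda>s. u s x) has_real_derivative
        (deriv (deriv (u t)) x + log_heat_nonlinearity lam (u t x))) (at t))"

definition steady_state :: "real \<Rightarrow> (real \<Rightarrow> real) \<Rightarrow> bool" where
  "steady_state lam \<phi> \<longleftrightarrow> C2_real \<phi> \<and> log_heat_equation lam (\<lambda>t. \<phi>)"

definition nonneg_nontrivial_decaying_steady_state :: "real \<Rightarrow> (real \<Rightarrow> real) \<Rightarrow> bool" where
  "nonneg_nontrivial_decaying_steady_state lam \<phi> \<longleftrightarrow>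
     steady_state lam \<phi> \<and>
     (\<forall>x. 0 \<le> \<phi> x) \<and>
     (\<exists>x. \<phi> x \<noteq> 0) \<and>
     (\<phi> \<longlongrightarrow> 0) at_top \<and> (\<phi> \<longlongrightarrow> 0) at_bot"

definition gausson :: "real \<Rightarrow> real \<Rightarrow> real" where
  "gausson lam x = exp (1 / 2) * exp (- (lam / 2) * x\<^sup>2)"

end

theory Submission
  imports Defs "HOL-Real_Asymp.Real_Asymp"
begin

text \<open>
  The energy \<open>\<phi>'\<^sup>2 + lam * \<phi>\<^sup>2 * (ln (\<phi>\<^sup>2) - 1)\<close> is constant along a solution, and decay at
  infinity forces it to vanish. Where \<open>\<phi> > 0\<close>, vanishing of the energy and the equation give
  \<open>(ln \<phi>)'' = - lam\<close>, so on every interval of positivity \<open>\<phi>\<close> is a translate of the Gaussian. As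
  the Gaussian stays positive at the end points of the interval, the interval is all of \<open>\<real>\<close>.
\<close>

text \<open>The primitive of \<open>4 * z * ln z\<close> on the positive half-line, normalised to
  vanish at 0. The square inside the logarithm makes it even, so that a two-sided derivative at 0
  makes sense.\<close>

definition energy_potential :: "real \<Rightarrow> real" where
  "energy_potential z = z\<^sup>2 * (ln (z\<^sup>2) - 1)"

text \<open>The case \<open>z = 0\<close> is included because a nonnegative solution might touch 0,
  and the energy must be differentiated there as well. The difference quotient at 0 is
  \<open>h * (ln (h\<^sup>2) - 1)\<close>, which tends to 0.\<close>

lemma energy_potential_has_deriv:
  assumes "z \<ge> 0"
  shows "(energy_potential has_real_derivative 2 * ode_nonlinearity 1 z) (at z)"
proof (cases "z = 0")
  case True
  have "((\<lambda>h::real. (h\<^sup>2 * (ln (h\<^sup>2) - 1)) / h) \<longlongrightarrow> 0) (at 0)"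
    by real_asymp
  then show ?thesis
    using True by (simp add: DERIV_def energy_potential_def ode_nonlinearity_def)
next
  case False
  then have "z > 0" using assms by simp
  then have "((\<lambda>z. z\<^sup>2 * (ln (z\<^sup>2) - 1)) has_real_derivative
      2 * z * (ln (z\<^sup>2) - 1) + 2 * z / z\<^sup>2 * z\<^sup>2) (at z)"
    by (auto intro!: derivative_eq_intros)
  also have "2 * z * (ln (z\<^sup>2) - 1) + 2 * z / z\<^sup>2 * z\<^sup>2 = 2 * (2 * z * ln z)"
    using \<open>z > 0\<close> by (simp add: ln_realpow algebra_simps)
  finally have "((\<lambda>z. z\<^sup>2 * (ln (z\<^sup>2) - 1)) has_real_derivative 2 * (2 * z * ln z)) (at z)" .
  then show ?thesis
    using False by (simp add: energy_potential_def[abs_def] ode_nonlinearity_def)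
qed

text \<open>Decay of \<open>f\<close> does not force \<open>f'\<close> to decay, but the mean value
  theorem on \<open>[n, n + 1]\<close> gives points where \<open>f'\<close> equals an increment of
  \<open>f\<close>. One such sequence suffices to evaluate a constant energy at infinity.\<close>

lemma deriv_along_sequence_tendsto_0:
  fixes f f' :: "real \<Rightarrow> real"
  assumes deriv: "\<And>x. (f has_real_derivative f' x) (at x)"
    and lim: "(f \<longlongrightarrow> 0) at_top"
  obtains s where "filterlim s at_top sequentially" "(\<lambda>n. f' (s n)) \<longlonglongrightarrow> 0"
proof -
  have "\<exists>z. real n < z \<and> f (real n + 1) - f (real n) = f' z" for n
    using MVT2[of "real n" "real n + 1" f f'] deriv by fastforce
  then obtain s where s: "\<And>n. real n < s n" "\<And>n. f (real n + 1) - f (real n) = f' (s n)"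
    by metis
  have top: "filterlim (\<lambda>n. real n) at_top sequentially"
    by (rule filterlim_real_sequentially)
  have "filterlim s at_top sequentially"
    by (rule filterlim_at_top_mono[OF top]) (simp add: s(1) less_imp_le)
  moreover have "(\<lambda>n. f (real n + 1) - f (real n)) \<longlonglongrightarrow> 0 - 0"
    by (intro tendsto_diff filterlim_compose[OF lim] top) real_asymp
  ultimately show thesis
    using that s(2) by simp
qed

lemma zero_deriv_imp_eq:
  fixes f :: "real \<Rightarrow> real"
  assumes "convex C" and "\<And>z. z \<in> C \<Longrightarrow> (f has_real_derivative 0) (at z)"
    and "x \<in> C" "y \<in> C"
  shows "f x = f y"
proof -
  have "\<exists>c. \<forall>z\<in>C. f z = c"
    by (rule has_field_derivative_zero_constant[OF assms(1)])
       (rule has_field_derivative_at_within[OF assms(2)])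
  then show ?thesis using assms(3,4) by metis
qed

locale decaying_solution =
  fixes lam :: real and \<phi> \<phi>' :: "real \<Rightarrow> real"
  assumes lam_pos: "lam > 0"
    and deriv: "\<And>x. (\<phi> has_real_derivative \<phi>' x) (at x)"
    and deriv2: "\<And>x. (\<phi>' has_real_derivative - ode_nonlinearity lam (\<phi> x)) (at x)"
    and nonneg: "\<And>x. 0 \<le> \<phi> x"
    and decay: "(\<phi> \<longlongrightarrow> 0) at_top"
begin

lemma energy_zero: "(\<phi>' x)\<^sup>2 + lam * energy_potential (\<phi> x) = 0"
proof -
  define E where "E = (\<lambda>x. (\<phi>' x)\<^sup>2 + lam * energy_potential (\<phi> x))"
  have "(E has_real_derivative 0) (at y)" for y
  proof -
    have "((\<lambda>x. energy_potential (\<phi> x)) has_real_derivative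
        2 * ode_nonlinearity 1 (\<phi> y) * \<phi>' y) (at y)"
      by (rule DERIV_chain2[OF energy_potential_has_deriv[OF nonneg] deriv])
    \<comment> \<open>The two terms cancel, since
      \<open>lam * ode_nonlinearity 1 z = ode_nonlinearity lam z\<close>.\<close>
    from DERIV_add[OF DERIV_power[OF deriv2, where n=2] DERIV_cmult[OF this, of lam]]
    show ?thesis
      by (simp add: E_def ode_nonlinearity_def algebra_simps split: if_splits)
  qed
  then have const: "E y = E x" for y
    using DERIV_isconst_all by blast
  obtain s where s: "filterlim s at_top sequentially" "(\<lambda>n. \<phi>' (s n)) \<longlonglongrightarrow> 0"
    using deriv_along_sequence_tendsto_0[OF deriv decay] .
  have "isCont energy_potential 0"
    using energy_potential_has_deriv[of 0] DERIV_isCont by blast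
  then have "(\<lambda>n. energy_potential (\<phi> (s n))) \<longlonglongrightarrow> energy_potential 0"
    by (rule isCont_tendsto_compose) (rule filterlim_compose[OF decay s(1)])
  with s(2) have "(\<lambda>n. E (s n)) \<longlonglongrightarrow> 0\<^sup>2 + lam * energy_potential 0"
    unfolding E_def by (intro tendsto_intros)
  then have "(\<lambda>n. E x) \<longlonglongrightarrow> 0"
    unfolding const[of "s _"] by (simp add: energy_potential_def)
  then have "E x = 0"
    by (rule LIMSEQ_unique[OF tendsto_const])
  then show ?thesis
    by (simp add: E_def)
qed

lemma deriv_squared:
  assumes "\<phi> x > 0"
  shows "(\<phi>' x)\<^sup>2 = lam * (\<phi> x)\<^sup>2 * (1 - 2 * ln (\<phi> x))"
  using energy_zero[of x] assms
  by (simp add: energy_potential_def ln_realpow algebra_simps)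

text \<open>The derivative is \<open>\<phi>'' / \<phi> - (\<phi>' / \<phi>)\<^sup>2\<close>, that
  is, \<open>- 2 * lam * ln \<phi> - lam * (1 - 2 * ln \<phi>)\<close>; the logarithms
  cancel.\<close>

lemma log_deriv_has_deriv:
  assumes "\<phi> x > 0"
  shows "((\<lambda>x. \<phi>' x / \<phi> x) has_real_derivative - lam) (at x)"
proof -
  have "(- ode_nonlinearity lam (\<phi> x) * \<phi> x - \<phi>' x * \<phi>' x) / (\<phi> x * \<phi> x) = - lam"
    using assms deriv_squared[OF assms]
    by (simp add: ode_nonlinearity_def field_simps power2_eq_square)
  with DERIV_divide[OF deriv2 deriv, of x] assms show ?thesis
    by simp
qed

text \<open>Integrating \<open>(ln \<phi>)'' = - lam\<close> twice leaves two constants. One is the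
  centre \<open>a\<close>; the other, the height, is fixed by the vanishing energy.\<close>

lemma eq_gausson_on_connected:
  assumes C: "connected C" "x\<^sub>0 \<in> C" and pos: "\<And>x. x \<in> C \<Longrightarrow> \<phi> x > 0"
  obtains a where "\<And>x. x \<in> C \<Longrightarrow> \<phi> x = gausson lam (x - a)"
proof -
  have conv: "convex C"
    using C(1) using is_interval_connected_1 is_interval_convex_1 by blast
  \<comment> \<open>The zero of the affine function of slope \<open>- lam\<close> that takes the
    value \<open>\<phi>' x\<^sub>0 / \<phi> x\<^sub>0\<close> at \<open>x\<^sub>0\<close>.\<close>
  define a where "a = x\<^sub>0 + \<phi>' x\<^sub>0 / (lam * \<phi> x\<^sub>0)"
  have p0: "\<phi> x\<^sub>0 > 0" using pos C(2) .
  have slope0: "\<phi>' x\<^sub>0 / \<phi> x\<^sub>0 = - lam * (x\<^sub>0 - a)"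
    using lam_pos p0 by (simp add: a_def)
  have slope: "\<phi>' x / \<phi> x = - lam * (x - a)" if "x \<in> C" for x
  proof -
    have "((\<lambda>x. \<phi>' x / \<phi> x + lam * (x - a)) has_real_derivative 0) (at y)" if "y \<in> C" for y
    proof -
      have "((\<lambda>x. lam * (x - a)) has_real_derivative lam) (at y)"
        by (auto intro!: derivative_eq_intros)
      from DERIV_add[OF log_deriv_has_deriv[OF pos[OF that]] this]
      show "((\<lambda>x. \<phi>' x / \<phi> x + lam * (x - a)) has_real_derivative 0) (at y)"
        by simp
    qed
    from zero_deriv_imp_eq[OF conv this that C(2)] slope0 show ?thesis by linarith
  qed
  \<comment> \<open>Comparing the squared slope from the energy with the affine formula determines
    the second constant as \<open>1 / 2\<close>.\<close>
  have "lam * (1 - 2 * ln (\<phi> x\<^sub>0)) = (\<phi>' x\<^sub>0 / \<phi> x\<^sub>0)\<^sup>2"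
    using deriv_squared[OF p0] p0 by (simp add: power_divide)
  also have "\<dots> = lam * (lam * (x\<^sub>0 - a)\<^sup>2)"
    unfolding slope0 by (simp add: power_mult_distrib power2_eq_square)
  finally have log0: "ln (\<phi> x\<^sub>0) + lam / 2 * (x\<^sub>0 - a)\<^sup>2 = 1 / 2"
    using lam_pos by simp
  have "\<phi> x = gausson lam (x - a)" if "x \<in> C" for x
  proof -
    have "((\<lambda>x. ln (\<phi> x) + lam / 2 * (x - a)\<^sup>2) has_real_derivative 0) (at y)"
      if "y \<in> C" for y
    proof -
      have "((\<lambda>x. ln (\<phi> x) + lam / 2 * (x - a)\<^sup>2) has_real_derivative
          \<phi>' y / \<phi> y + lam * (y - a)) (at y)"
        using pos[OF that] by (auto intro!: derivative_eq_intros deriv)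
      then show "((\<lambda>x. ln (\<phi> x) + lam / 2 * (x - a)\<^sup>2) has_real_derivative 0) (at y)"
        by (simp add: slope[OF that])
    qed
    from zero_deriv_imp_eq[OF conv this that C(2)] log0
    have "ln (\<phi> x) = 1 / 2 + - (lam / 2) * (x - a)\<^sup>2" by linarith
    then have "\<phi> x = exp (1 / 2 + - (lam / 2) * (x - a)\<^sup>2)"
      using pos[OF that] by (metis exp_ln)
    then show ?thesis
      by (simp only: gausson_def exp_add)
  qed
  then show thesis by (rule that)
qed

text \<open>Since \<open>z * ln z\<close> is not Lipschitz at 0, the usual uniqueness theorem does
  not rule out zeros of \<open>\<phi>\<close>. Instead, the component of positivity around
  \<open>x\<^sub>0\<close> is shown to be both open and closed.\<close>

lemma eq_gausson:
  assumes "\<phi> x\<^sub>0 \<noteq> 0"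
  obtains a where "\<And>x. \<phi> x = gausson lam (x - a)"
proof -
  have cont: "continuous_on UNIV \<phi>"
    using deriv DERIV_isCont continuous_at_imp_continuous_on by blast
  define T where "T = {x. 0 < \<phi> x}"
  have "open T"
    unfolding T_def by (intro open_Collect_less continuous_on_const cont)
  define C where "C = connected_component_set T x\<^sub>0"
  have x0: "x\<^sub>0 \<in> T"
    using assms nonneg[of x\<^sub>0] by (simp add: T_def)
  have C: "connected C" "x\<^sub>0 \<in> C" "C \<subseteq> T" "open C"
    using x0 \<open>open T\<close> by (auto simp: C_def open_connected_component connected_component_subset)
  obtain a where a: "\<And>x. x \<in> C \<Longrightarrow> \<phi> x = gausson lam (x - a)"
    using eq_gausson_on_connected[OF C(1,2)] C(3) by (auto simp: T_def)
  have "continuous_on UNIV (\<lambda>x. gausson lam (x - a))"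
    unfolding gausson_def by (intro continuous_intros)
  then have "closed {x. \<phi> x = gausson lam (x - a)}"
    by (intro closed_Collect_eq cont)
  then have "closure C \<subseteq> {x. \<phi> x = gausson lam (x - a)}"
    using a by (intro closure_minimal) auto
  \<comment> \<open>Agreement with the Gaussian passes to the closure by continuity, so
    \<open>\<phi>\<close> cannot vanish at a boundary point of \<open>C\<close>.\<close>
  then have "closure C \<subseteq> T"
    by (auto simp: T_def gausson_def)
  \<comment> \<open>The closure is a connected subset of \<open>T\<close> containing
    \<open>x\<^sub>0\<close>, so maximality of the component applies.\<close>
  then have "closure C \<subseteq> C"
    using connected_component_maximal[of x\<^sub>0 "closure C" T] C(1,2) closure_subset[of C]
      connected_imp_connected_closure
    unfolding C_def by blast
  then have "closed C"
    using closure_subset[of C] closure_eq by blast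
  with C(2,4) have "C = UNIV"
    using clopen by blast
  with a show thesis by (intro that) auto
qed

end

text \<open>The time derivative of a constant is 0, and \<open>ln (z\<^sup>2) = 2 * ln z\<close> for
  positive \<open>z\<close> identifies the two nonlinearities.\<close>

lemma log_heat_equation_const_iff:
  assumes "\<And>x. 0 \<le> \<phi> x"
  shows "log_heat_equation lam (\<lambda>t. \<phi>) \<longleftrightarrow>
    (\<forall>x. deriv (deriv \<phi>) x + ode_nonlinearity lam (\<phi> x) = 0)"
proof -
  have nonlin: "log_heat_nonlinearity lam (\<phi> x) = ode_nonlinearity lam (\<phi> x)" for x
    using assms[of x] by (simp add: log_heat_nonlinearity_def ode_nonlinearity_def ln_realpow)
  have "((\<lambda>s. \<phi> x) has_real_derivative D) (at t) \<longleftrightarrow> D = 0" for x D t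
    using DERIV_unique[OF DERIV_const] by auto
  then show ?thesis
    unfolding log_heat_equation_def nonlin by (auto intro: exI[of _ 1])
qed

lemma steady_state_iff:
  assumes "\<And>x. 0 \<le> \<phi> x"
  shows "steady_state lam \<phi> \<longleftrightarrow>
    C2_real \<phi> \<and> (\<forall>x. deriv (deriv \<phi>) x + ode_nonlinearity lam (\<phi> x) = 0)"
  unfolding steady_state_def log_heat_equation_const_iff[OF assms] ..

lemma gausson_solution:
  assumes "lam > 0"
  shows "nonneg_nontrivial_decaying_steady_state lam (gausson lam)"
proof -
  have D: "(gausson lam has_real_derivative - lam * x * gausson lam x) (at x)" for x
    unfolding gausson_def[abs_def] by (auto intro!: derivative_eq_intros)
  have d1: "deriv (gausson lam) = (\<lambda>x. - lam * x * gausson lam x)"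
    using DERIV_imp_deriv[OF D] by auto
  have D2: "(deriv (gausson lam) has_real_derivative (lam\<^sup>2 * x\<^sup>2 - lam) * gausson lam x) (at x)" for x
    unfolding d1
    by (auto intro!: derivative_eq_intros D simp: algebra_simps power2_eq_square)
  have d2: "deriv (deriv (gausson lam)) = (\<lambda>x. (lam\<^sup>2 * x\<^sup>2 - lam) * gausson lam x)"
    using DERIV_imp_deriv[OF D2] by auto
  have pos: "gausson lam x > 0" for x
    by (simp add: gausson_def)
  have "C2_real (gausson lam)"
    unfolding C2_real_def
  proof (intro conjI allI)
    show "continuous_on UNIV (deriv (deriv (gausson lam)))"
      unfolding d2 gausson_def by (intro continuous_intros)
  qed (use D D2 real_differentiable_def in blast)+
  moreover have "deriv (deriv (gausson lam)) x + ode_nonlinearity lam (gausson lam x) = 0" for x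
  proof -
    \<comment> \<open>The logarithm turns the nonlinearity into
      \<open>(lam - lam\<^sup>2 * x\<^sup>2) * gausson lam x\<close>, the negative of
      \<open>d2\<close>.\<close>
    have "ln (gausson lam x) = 1 / 2 - lam / 2 * x\<^sup>2"
      by (simp add: gausson_def ln_mult)
    then have "ode_nonlinearity lam (gausson lam x) =
        2 * lam * gausson lam x * (1 / 2 - lam / 2 * x\<^sup>2)"
      using pos[of x] by (simp add: ode_nonlinearity_def)
    then show ?thesis
      by (simp add: d2 algebra_simps power2_eq_square)
  qed
  moreover have "(gausson lam \<longlongrightarrow> 0) at_top" "(gausson lam \<longlongrightarrow> 0) at_bot"
    using assms unfolding gausson_def[abs_def] by real_asymp+
  moreover have "\<And>x. 0 \<le> gausson lam x" "gausson lam 0 \<noteq> 0"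
    using pos less_imp_le by (blast, simp add: gausson_def)
  ultimately show ?thesis
    unfolding nonneg_nontrivial_decaying_steady_state_def
    using steady_state_iff[of "gausson lam" lam] by blast
qed

lemma steady_state_eq_gausson:
  assumes "lam > 0" and "nonneg_nontrivial_decaying_steady_state lam \<phi>"
  shows "\<exists>a. \<forall>x. \<phi> x = gausson lam (x - a)"
proof -
  have \<phi>: "steady_state lam \<phi>" "\<And>x. 0 \<le> \<phi> x" "\<exists>x. \<phi> x \<noteq> 0" "(\<phi> \<longlongrightarrow> 0) at_top"
    using assms(2) by (auto simp: nonneg_nontrivial_decaying_steady_state_def)
  have C2: "C2_real \<phi>" and ode: "\<And>x. deriv (deriv \<phi>) x + ode_nonlinearity lam (\<phi> x) = 0"
    using \<phi>(1) steady_state_iff[OF \<phi>(2)] by auto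
  \<comment> \<open>\<open>C2_real\<close> ensures that the values of the total function
    \<open>deriv\<close> are genuine derivatives here.\<close>
  interpret decaying_solution lam \<phi> "deriv \<phi>"
  proof
    show "(\<phi> has_real_derivative deriv \<phi> x) (at x)" for x
      using C2 by (simp add: C2_real_def DERIV_deriv_iff_real_differentiable)
    show "(deriv \<phi> has_real_derivative - ode_nonlinearity lam (\<phi> x)) (at x)" for x
      using C2 ode[of x] DERIV_deriv_iff_real_differentiable[of "deriv \<phi>" x]
      by (simp add: C2_real_def add_eq_0_iff2)
  qed (use assms(1) \<phi> in auto)
  from \<phi>(3) obtain x\<^sub>0 where "\<phi> x\<^sub>0 \<noteq> 0" by blast
  with eq_gausson show ?thesis by metis
qed

theorem proposition2p1:
  fixes lam :: real
  assumes "lam > 0"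
  shows "(\<forall>\<phi>. (\<forall>x. 0 \<le> \<phi> x) \<longrightarrow>
            (steady_state lam \<phi> \<longleftrightarrow>
               C2_real \<phi> \<and> (\<forall>x. deriv (deriv \<phi>) x + ode_nonlinearity lam (\<phi> x) = 0)))
       \<and> nonneg_nontrivial_decaying_steady_state lam (gausson lam)
       \<and> (\<forall>\<phi>. nonneg_nontrivial_decaying_steady_state lam \<phi> \<longrightarrow>
            (\<exists>a. \<forall>x. \<phi> x = gausson lam (x - a)))"
  using steady_state_iff gausson_solution[OF assms] steady_state_eq_gausson[OF assms] by blast

end
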